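(* Let $(P_\lambda)_{\lambda\in[0,1]}$ be a family of bond percolation models on $\mathbb{Z}^2$ such that: (i) (monotonicity) for every increasing event $A$, the map $\lambda\mapsto P_\lambda(A)$ is non-decreasing; (ii) for every $\lambda$, $P_\lambda$ is invariant under the symmetries of $\mathbb{Z}^2$ and ergodic with respect to shifts; (iii) for every $\lambda$, $P_\lambda$ satisfies the FKG inequality: $P_\lambda(A\cap B)\ge P_\lambda(A)P_\lambda(B)$ for all increasing events $A,B$; (iv) there exists a non-increasing sequence $(r_n)$ of non-negative reals with $\sum_{n\ge1} r_n/n<\infty$ such that, for every $n\ge 1$, every $\lambda\in[0,1]$, and all events $A$ and $B$ with supports in $[-3n,3n]^2$ and $\mathbb{Z}^2\setminus[-4n,4n]^2$, respectively, $\mathrm{Cov}_\lambda(\mathbf 1_A,\mathbf 1_B)\le r_n$; (v) for every finitely-supported non-trivial increasing event $A$, $\lim_{\lambda\to0}P_\lambda(A)=0$ and $\lim_{\lambda\to1}P_\lambda(A)=1$. Then the phase transition is non-trivial: with $\theta(\lambda)=P_\lambda(0\leftrightarrow\infty)$, the threshold $\lambda_c=\inf\{\lambda:\theta(\lambda)>0\}$ is well defined and satisfies $\lambda_c\in(0,1)$.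
   Context: A bond percolation model on $\mathbb{Z}^2$ is a probability measure on configurations $\omega\in\{0,1\}^{E}$ (with the product $\sigma$-algebra), where $E$ is the set of nearest-neighbour edges of $\mathbb{Z}^2$; an edge $e$ is open if $\omega_e=1$. An event is increasing if its indicator is non-decreasing in $\omega$ for the coordinatewise order. An event has support in $S\subseteq\mathbb{Z}^2$ if it depends only on the states of edges with both endpoints in $S$; it is finitely-supported if it depends on finitely many edges; it is non-trivial if it is neither empty nor the whole configuration space. Symmetries of $\mathbb{Z}^2$ are translations, rotations by multiples of $\pi/2$, and reflections preserving $\mathbb{Z}^2$; ergodic with respect to shifts means every event invariant under all translations of $\mathbb{Z}^2$ has probability $0$ or $1$. $\mathrm{Cov}_\lambda$ is covariance under $P_\lambda$. $\{0\leftrightarrow\infty\}$ is the event that the origin lies in an infinite connected component of open edges. *)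

theory Defs
  imports "HOL-Probability.Probability"
begin

type_synonym vertex = "int \<times> int"
type_synonym edge = "vertex set"
type_synonym config = "edge \<Rightarrow> bool"

definition edges :: "edge set" where
  "edges = {{(a, b), (c, d)} | a b c d. \<bar>a - c\<bar> + \<bar>b - d\<bar> = 1}"

text \<open>The space \<open>{0,1}\<^sup>E\<close> with its product sigma-algebra. The states 0 and 1 are
  \<^term>\<open>False\<close> and \<^term>\<open>True\<close>; configurations are undefined outside \<open>edges\<close>.\<close>

definition config_space :: "config measure" where
  "config_space = PiM edges (\<lambda>_. count_space (UNIV :: bool set))"

definition bond_percolation :: "config measure \<Rightarrow> bool" where
  "bond_percolation M \<longleftrightarrow> prob_space M \<and> sets M = sets config_space"

definition increasing_event :: "config set \<Rightarrow> bool" where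
  "increasing_event A \<longleftrightarrow> A \<in> sets config_space \<and>
     (\<forall>\<omega>\<in>A. \<forall>\<omega>'\<in>space config_space. (\<forall>e\<in>edges. \<omega> e \<le> \<omega>' e) \<longrightarrow> \<omega>' \<in> A)"

definition depends_only_on :: "edge set \<Rightarrow> config set \<Rightarrow> bool" where
  "depends_only_on F A \<longleftrightarrow>
     (\<forall>\<omega>\<in>space config_space. \<forall>\<omega>'\<in>space config_space.
        (\<forall>e\<in>F. \<omega> e = \<omega>' e) \<longrightarrow> (\<omega> \<in> A \<longleftrightarrow> \<omega>' \<in> A))"

definition supported_in :: "vertex set \<Rightarrow> config set \<Rightarrow> bool" where
  "supported_in S A \<longleftrightarrow> depends_only_on {e \<in> edges. e \<subseteq> S} A"

definition finitely_supported :: "config set \<Rightarrow> bool" where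
  "finitely_supported A \<longleftrightarrow> (\<exists>F\<subseteq>edges. finite F \<and> depends_only_on F A)"

definition nontrivial_event :: "config set \<Rightarrow> bool" where
  "nontrivial_event A \<longleftrightarrow> A \<noteq> {} \<and> A \<noteq> space config_space"

definition lattice_translations :: "(vertex \<Rightarrow> vertex) set" where
  "lattice_translations = {\<lambda>(x, y). (x + a, y + b) | a b. True}"

text \<open>Rotations about points other than the origin are compositions of these with translations.\<close>

definition lattice_rotations :: "(vertex \<Rightarrow> vertex) set" where
  "lattice_rotations = {(\<lambda>(x, y). (- y, x)) ^^ k | k. True}"

text \<open>The reflections of the plane preserving the lattice are those in the lines
  \<open>2 x = k\<close>, \<open>2 y = k\<close>, \<open>x - y = k\<close> and \<open>x + y = k\<close> for an integer \<open>k\<close>.\<close>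

definition lattice_reflections :: "(vertex \<Rightarrow> vertex) set" where
  "lattice_reflections =
     {\<lambda>(x, y). (k - x, y) | k. True} \<union> {\<lambda>(x, y). (x, k - y) | k. True} \<union>
     {\<lambda>(x, y). (y + k, x - k) | k. True} \<union> {\<lambda>(x, y). (k - y, k - x) | k. True}"

definition config_map :: "(vertex \<Rightarrow> vertex) \<Rightarrow> config \<Rightarrow> config" where
  "config_map \<sigma> \<omega> = (\<lambda>e\<in>edges. \<omega> (\<sigma> ` e))"

definition symmetry_invariant :: "config measure \<Rightarrow> bool" where
  "symmetry_invariant M \<longleftrightarrow>
     (\<forall>\<sigma> \<in> lattice_translations \<union> lattice_rotations \<union> lattice_reflections.
        distr M config_space (config_map \<sigma>) = M)"

definition shift_ergodic :: "config measure \<Rightarrow> bool" where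
  "shift_ergodic M \<longleftrightarrow>
     (\<forall>A\<in>sets config_space.
        (\<forall>\<tau>\<in>lattice_translations. config_map \<tau> -` A \<inter> space config_space = A) \<longrightarrow>
        measure M A = 0 \<or> measure M A = 1)"

definition FKG_inequality :: "config measure \<Rightarrow> bool" where
  "FKG_inequality M \<longleftrightarrow>
     (\<forall>A B. increasing_event A \<longrightarrow> increasing_event B \<longrightarrow>
        measure M (A \<inter> B) \<ge> measure M A * measure M B)"

definition covariance :: "'a measure \<Rightarrow> ('a \<Rightarrow> real) \<Rightarrow> ('a \<Rightarrow> real) \<Rightarrow> real" where
  "covariance M X Y =
     (\<integral>\<omega>. (X \<omega> - (\<integral>\<omega>'. X \<omega>' \<partial>M)) * (Y \<omega> - (\<integral>\<omega>'. Y \<omega>' \<partial>M)) \<partial>M)"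

definition square_box :: "nat \<Rightarrow> vertex set" where
  "square_box n = {- int n..int n} \<times> {- int n..int n}"

definition cluster :: "config \<Rightarrow> vertex \<Rightarrow> vertex set" where
  "cluster \<omega> x = {y. (x, y) \<in> {(u, v). {u, v} \<in> edges \<and> \<omega> {u, v}}\<^sup>*}"

definition origin_to_infinity :: "config set" where
  "origin_to_infinity = {\<omega> \<in> space config_space. infinite (cluster \<omega> (0, 0))}"

definition theta :: "(real \<Rightarrow> config measure) \<Rightarrow> real \<Rightarrow> real" where
  "theta P l = measure (P l) origin_to_infinity"

text \<open>This set is bounded below by 0, so the critical parameter is well defined exactly when the
  set is nonempty.\<close>

definition percolating_parameters :: "(real \<Rightarrow> config measure) \<Rightarrow> real set" where
  "percolating_parameters P = {l \<in> {0..1}. theta P l > 0}"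

definition critical_parameter :: "(real \<Rightarrow> config measure) \<Rightarrow> real" where
  "critical_parameter P = Inf (percolating_parameters P)"

end

theory Submission
  imports Defs
begin

text \<open>Renormalization on boxes of side \<open>L\<^sub>k = 16\<^sup>K * 16\<^sup>k\<close>. If a bad event at scale \<open>k + 1\<close>
  forces two bad events at scale \<open>k\<close> in distant boxes, decoupling bounds the bad probabilities by
  \<open>q\<^bsub>k+1\<^esub> \<le> C (q\<^sub>k\<^sup>2 + r(L\<^sub>k))\<close>, and \<open>\<Sum>\<^sub>k r(L\<^sub>k)\<close> converges by Cauchy condensation; so \<open>\<Sum>\<^sub>k q\<^sub>k\<close>
  is small as soon as \<open>q\<^sub>0\<close> is, once \<open>K\<close> is large. The limits at \<open>0\<close> and \<open>1\<close> make \<open>q\<^sub>0\<close> small in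
  the following two cases.

  For \<open>\<lambda>\<close> near 0, bad means that a box is joined to the boundary of its threefold enlargement: the
  two ends of a long open path give two distant paths at the smaller scale.

  For \<open>\<lambda>\<close> near 1, a box is good if no two distant ones among its \<open>16 * 16\<close> children are bad. The
  good rows and columns of children then form a connected skeleton, and the skeletons of adjacent
  good boxes are connected because the boxes share a good row or column. With positive probability
  all children of the box at the origin are good at all scales, and their skeletons join the origin
  to infinity.\<close>

subsection \<open>Connections inside a set of vertices\<close>

text \<open>Both endpoints of every step must lie in \<open>S\<close>, so events phrased with
  \<open>conn S\<close> depend only on edges inside \<open>S\<close>. The relation is reflexive even
  at vertices outside \<open>S\<close>.\<close>

definition conn :: "vertex set \<Rightarrow> config \<Rightarrow> (vertex \<times> vertex) set" where
  "conn S \<omega> = {(u, v). {u, v} \<in> edges \<and> \<omega> {u, v} \<and> u \<in> S \<and> v \<in> S}\<^sup>*"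

text \<open>The inner vertex boundary: being part of \<open>S\<close>, it can be reached through
  edges inside \<open>S\<close>.\<close>

definition rim :: "vertex set \<Rightarrow> vertex set" where
  "rim S = {w \<in> S. \<exists>v. {w, v} \<in> edges \<and> v \<notin> S}"

lemma cluster_conn: "cluster \<omega> x = {y. (x, y) \<in> conn UNIV \<omega>}"
  by (simp add: cluster_def conn_def)

lemma conn_refl [simp]: "(x, x) \<in> conn S \<omega>"
  by (simp add: conn_def)

lemma conn_trans: "(x, y) \<in> conn S \<omega> \<Longrightarrow> (y, z) \<in> conn S \<omega> \<Longrightarrow> (x, z) \<in> conn S \<omega>"
  unfolding conn_def by (rule rtrancl_trans)

lemma conn_sym: "(x, y) \<in> conn S \<omega> \<Longrightarrow> (y, x) \<in> conn S \<omega>"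
proof -
  have "sym {(u, v). {u, v} \<in> edges \<and> \<omega> {u, v} \<and> u \<in> S \<and> v \<in> S}"
    by (auto simp: sym_def insert_commute)
  then show "(x, y) \<in> conn S \<omega> \<Longrightarrow> (y, x) \<in> conn S \<omega>"
    unfolding conn_def by (meson sym_rtrancl symD)
qed

lemma conn_mono: "S \<subseteq> T \<Longrightarrow> conn S \<omega> \<subseteq> conn T \<omega>"
  unfolding conn_def by (rule rtrancl_mono) auto

lemma conn_cong:
  assumes "\<And>e. e \<in> edges \<Longrightarrow> e \<subseteq> S \<Longrightarrow> \<omega> e = \<omega>' e"
  shows "conn S \<omega> = conn S \<omega>'"
  unfolding conn_def using assms by (intro arg_cong[where f = rtrancl]) auto

lemma conn_edge: "{u, v} \<in> edges \<Longrightarrow> \<omega> {u, v} \<Longrightarrow> u \<in> S \<Longrightarrow> v \<in> S \<Longrightarrow> (u, v) \<in> conn S \<omega>"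
  unfolding conn_def by (rule r_into_rtrancl) simp

lemma conn_open_edge:
  assumes "(x, y) \<in> conn S \<omega>" "x \<noteq> y"
  shows "\<exists>e\<in>edges. e \<subseteq> S \<and> \<omega> e"
proof -
  obtain z where "(x, z) \<in> {(u, v). {u, v} \<in> edges \<and> \<omega> {u, v} \<and> u \<in> S \<and> v \<in> S}"
    using assms unfolding conn_def by (meson converse_rtranclE)
  then have "{x, z} \<in> edges \<and> {x, z} \<subseteq> S \<and> \<omega> {x, z}" by simp
  then show ?thesis by blast
qed

text \<open>Follow the path up to its first exit from \<open>S\<close>: the last vertex before the
  exit lies on the rim, and everything up to it stays inside \<open>S\<close>.\<close>

lemma conn_reaches_rim:
  assumes "(x, y) \<in> conn UNIV \<omega>" "x \<in> S" "y \<notin> S"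
  shows "\<exists>w\<in>rim S. (x, w) \<in> conn S \<omega>"
proof -
  \<comment> \<open>Induction along the path: either it has stayed in \<open>S\<close> so far, or
    the rim has already been reached, which remains true from then on.\<close>
  have "(y \<in> S \<and> (x, y) \<in> conn S \<omega>) \<or> (\<exists>w\<in>rim S. (x, w) \<in> conn S \<omega>)"
    using assms(1) unfolding conn_def[of UNIV]
  proof (induction rule: rtrancl_induct)
    case base
    then show ?case using assms(2) by simp
  next
    case (step y z)
    then show ?case
    proof (elim disjE)
      assume y: "y \<in> S \<and> (x, y) \<in> conn S \<omega>"
      show ?thesis
      proof (cases "z \<in> S")
        case True
        then have "(y, z) \<in> conn S \<omega>" using y step(2) by (auto intro: conn_edge)
        then show ?thesis using y True conn_trans by blast
      next
        case False
        then have "y \<in> rim S" using y step(2) unfolding rim_def by blast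
        then show ?thesis using y by blast
      qed
    qed auto
  qed
  then show ?thesis using assms(3) by blast
qed

text \<open>Serves at two levels: along segments of lattice points, and along rows and columns of
  boxes, where \<open>f\<close> picks a representative of each box.\<close>

lemma conn_chain:
  fixes f :: "int \<Rightarrow> vertex"
  assumes "\<And>i. a \<le> i \<Longrightarrow> i < b \<Longrightarrow> (f i, f (i + 1)) \<in> conn S \<omega>"
    and "i \<in> {a..b}" "j \<in> {a..b}"
  shows "(f i, f j) \<in> conn S \<omega>"
proof -
  have *: "(f a, f j) \<in> conn S \<omega>" if "a \<le> j" "j \<le> b" for j
    using that
  proof (induction j rule: int_ge_induct)
    case (step j)
    then show ?case using assms(1)[of j] conn_trans by fastforce
  qed simp
  show ?thesis using *[of i] *[of j] assms(2,3) conn_sym conn_trans by (meson atLeastAtMost_iff)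
qed

lemma edge_iff: "{(a, b), (c, d)} \<in> edges \<longleftrightarrow> \<bar>a - c\<bar> + \<bar>b - d\<bar> = 1"
proof -
  have "\<bar>a - c\<bar> + \<bar>b - d\<bar> = 1"
    if "{(a, b), (c, d)} = {(a', b'), (c', d')}" "\<bar>a' - c'\<bar> + \<bar>b' - d'\<bar> = 1" for a' b' c' d' :: int
    using that by (auto simp: doubleton_eq_iff)
  then show ?thesis unfolding edges_def by blast
qed

lemma edgeE:
  assumes "e \<in> edges"
  obtains a b c d where "e = {(a, b), (c, d)}" "\<bar>a - c\<bar> + \<bar>b - d\<bar> = 1"
  using assms unfolding edges_def by blast

section \<open>Measurability of connection events\<close>

lemma measurable_edge_state [measurable]:
  "e \<in> edges \<Longrightarrow> (\<lambda>\<omega>. \<omega> e) \<in> measurable config_space (count_space UNIV)"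
  unfolding config_space_def by (rule measurable_component_singleton)

text \<open>Reachability is a countable union over path lengths, and a path of length
  \<open>Suc n\<close> is a countable union over its last intermediate vertex.\<close>

lemma measurable_conn [measurable]:
  "Measurable.pred config_space (\<lambda>\<omega>. (x, y) \<in> conn S \<omega>)"
proof -
  define R where "R \<omega> = {(u, v). {u, v} \<in> edges \<and> \<omega> {u, v} \<and> u \<in> S \<and> v \<in> S}" for \<omega> :: config
  have R [measurable]: "Measurable.pred config_space (\<lambda>\<omega>. (u, v) \<in> R \<omega>)" for u v
  proof (cases "{u, v} \<in> edges")
    case True
    then have [measurable]: "Measurable.pred config_space (\<lambda>\<omega>. \<omega> {u, v})"
      by (rule measurable_edge_state)
    show ?thesis unfolding R_def by simp
  next
    case False
    then show ?thesis unfolding R_def by simp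
  qed
  have [measurable]: "Measurable.pred config_space (\<lambda>\<omega>. (x, y) \<in> R \<omega> ^^ n)" for n
  proof (induction n arbitrary: y)
    case 0
    then show ?case by simp
  next
    case (Suc n)
    note [measurable] = Suc
    have "((x, y) \<in> R \<omega> ^^ Suc n) \<longleftrightarrow> (\<exists>z. (x, z) \<in> R \<omega> ^^ n \<and> (z, y) \<in> R \<omega>)" for \<omega>
      by auto
    then show ?case by simp
  qed
  have "(x, y) \<in> conn S \<omega> \<longleftrightarrow> (\<exists>n. (x, y) \<in> R \<omega> ^^ n)" for \<omega>
    unfolding conn_def R_def[symmetric] by (simp add: rtrancl_power)
  then show ?thesis by simp
qed

text \<open>Turns infiniteness into a condition with countable quantifiers. This gives measurability
  of percolation, and later reduces percolation to reaching arbitrarily far.\<close>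

lemma infinite_iff_leaves_boxes:
  "infinite (C :: vertex set) \<longleftrightarrow> (\<forall>n. \<exists>y. y \<notin> square_box n \<and> y \<in> C)"
proof
  assume "infinite C"
  moreover have "finite (square_box n)" for n by (simp add: square_box_def)
  ultimately show "\<forall>n. \<exists>y. y \<notin> square_box n \<and> y \<in> C" by (meson finite_subset subsetI)
next
  assume *: "\<forall>n. \<exists>y. y \<notin> square_box n \<and> y \<in> C"
  show "infinite C"
  proof
    assume "finite C"
    define N where "N = Max (insert 0 ((\<lambda>(a, b). max (nat \<bar>a\<bar>) (nat \<bar>b\<bar>)) ` C))"
    have "max (nat \<bar>a\<bar>) (nat \<bar>b\<bar>) \<le> N" if "(a, b) \<in> C" for a b
      unfolding N_def using \<open>finite C\<close> that by (intro Max_ge) force+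
    then have "C \<subseteq> square_box N" by (force simp: square_box_def)
    with * show False by blast
  qed
qed

lemma sets_origin_to_infinity: "origin_to_infinity \<in> sets config_space"
  unfolding origin_to_infinity_def infinite_iff_leaves_boxes cluster_conn mem_Collect_eq
  by measurable

subsection \<open>Translations\<close>

definition shift_by :: "vertex \<Rightarrow> vertex \<Rightarrow> vertex" where
  "shift_by v = (\<lambda>(x, y). (x + fst v, y + snd v))"

lemma shift_in_translations: "shift_by v \<in> lattice_translations"
  unfolding shift_by_def lattice_translations_def by blast

lemma shift_image_edge: "shift_by v ` e \<in> edges \<longleftrightarrow> e \<in> edges"
proof -
  have *: "e \<in> edges \<Longrightarrow> shift_by v ` e \<in> edges" for v e
    by (erule edgeE) (simp add: shift_by_def edge_iff)
  have "shift_by (- fst v, - snd v) ` shift_by v ` e = e"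
    by (force simp: shift_by_def image_image split_beta)
  then show ?thesis using * by metis
qed

lemma measurable_config_map_shift [measurable]:
  "config_map (shift_by v) \<in> measurable config_space config_space"
  unfolding config_map_def[abs_def]
  by (subst (2) config_space_def, rule measurable_restrict, rule measurable_edge_state)
    (simp add: shift_image_edge)

section \<open>Decoupling of distant regions at one fixed parameter\<close>

locale decoupled_percolation =
  fixes M :: "config measure" and r :: "nat \<Rightarrow> real"
  assumes model: "bond_percolation M"
    and invariance: "symmetry_invariant M"
    and r_nonneg: "n \<ge> 1 \<Longrightarrow> r n \<ge> 0"
    and decoupling: "n \<ge> 1 \<Longrightarrow>
          A \<in> sets config_space \<Longrightarrow> B \<in> sets config_space \<Longrightarrow>
          supported_in (square_box (3 * n)) A \<Longrightarrow> supported_in (- square_box (4 * n)) B \<Longrightarrow>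
          covariance M (indicator A) (indicator B) \<le> r n"
begin

sublocale prob_space M
  using model by (simp add: bond_percolation_def)

lemma sets_M [simp, measurable_cong]: "sets M = sets config_space"
  using model by (simp add: bond_percolation_def)

lemma space_M [simp]: "space M = space config_space"
  by (rule sets_eq_imp_space_eq) simp

lemma prob_shift:
  assumes "A \<in> sets config_space"
  shows "prob (config_map (shift_by v) -` A \<inter> space config_space) = prob A"
proof -
  have "distr M config_space (config_map (shift_by v)) = M"
    using invariance shift_in_translations by (auto simp: symmetry_invariant_def)
  moreover have "measure (distr M config_space (config_map (shift_by v))) A =
      prob (config_map (shift_by v) -` A \<inter> space M)"
    using assms by (intro measure_distr) measurable
  ultimately show ?thesis by simp
qed

lemma covariance_indicator:
  assumes "A \<in> sets config_space" "B \<in> sets config_space"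
  shows "covariance M (indicator A) (indicator B) = prob (A \<inter> B) - prob A * prob B"
proof -
  have [measurable]: "A \<in> sets M" "B \<in> sets M" using assms by simp_all
  have "covariance M (indicator A) (indicator B) =
    (\<integral>\<omega>. indicator (A \<inter> B) \<omega> - prob B * indicator A \<omega> - prob A * indicator B \<omega> + prob A * prob B \<partial>M)"
    unfolding covariance_def using assms
    by (intro Bochner_Integration.integral_cong) (auto simp: algebra_simps indicator_def)
  also have "\<dots> = prob (A \<inter> B) - prob B * prob A - prob A * prob B + prob A * prob B"
    using assms by (simp add: prob_space[unfolded space_M] Bochner_Integration.integral_diff
        Bochner_Integration.integral_add integrable_real_indicator less_top[symmetric])
  finally show ?thesis by (simp add: mult.commute)
qed

text \<open>Translate the centre \<open>v\<close> to the origin, apply the decoupling hypothesis to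
  the pulled-back events, and remove the translation by invariance of the measure.\<close>

lemma decoupling_shift:
  assumes n: "n \<ge> 1" and A: "A \<in> sets config_space" and B: "B \<in> sets config_space"
    and S: "supported_in S A" "S \<subseteq> shift_by v ` square_box (3 * n)"
    and T: "supported_in T B" "T \<inter> shift_by v ` square_box (4 * n) = {}"
  shows "prob (A \<inter> B) \<le> prob A * prob B + r n"
proof -
  define w where "w = (- fst v, - snd v)"
  define pull where "pull A = config_map (shift_by w) -` A \<inter> space config_space" for A
  have sets: "pull A \<in> sets config_space" if "A \<in> sets config_space" for A
    unfolding pull_def using that by measurable
  have supp: "supported_in U' (pull A)"
    if "supported_in U A" "shift_by w ` U \<subseteq> U'" for U U' A
    unfolding supported_in_def depends_only_on_def
  proof (intro ballI impI)
    fix \<omega> \<omega>' assume \<omega>: "\<omega> \<in> space config_space" "\<omega>' \<in> space config_space"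
      and eq: "\<forall>e\<in>{e \<in> edges. e \<subseteq> U'}. \<omega> e = \<omega>' e"
    have "config_map (shift_by w) \<omega> e = config_map (shift_by w) \<omega>' e" if "e \<in> edges" "e \<subseteq> U" for e
    proof -
      have "shift_by w ` e \<in> {e \<in> edges. e \<subseteq> U'}"
        using that \<open>shift_by w ` U \<subseteq> U'\<close> by (auto simp: shift_image_edge)
      then show ?thesis using eq that by (simp add: config_map_def)
    qed
    moreover have "config_map (shift_by w) \<omega> \<in> space config_space"
      "config_map (shift_by w) \<omega>' \<in> space config_space"
      using \<omega> measurable_space[OF measurable_config_map_shift] by auto
    ultimately have "config_map (shift_by w) \<omega> \<in> A \<longleftrightarrow> config_map (shift_by w) \<omega>' \<in> A"
      using \<open>supported_in U A\<close> unfolding supported_in_def depends_only_on_def by blast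
    then show "\<omega> \<in> pull A \<longleftrightarrow> \<omega>' \<in> pull A" using \<omega> by (simp add: pull_def)
  qed
  have inv: "shift_by w (shift_by v x) = x" "shift_by v (shift_by w x) = x" for x
    by (auto simp: shift_by_def w_def split_beta)
  have "shift_by w ` S \<subseteq> square_box (3 * n)" using S(2) inv by force
  then have 1: "supported_in (square_box (3 * n)) (pull A)" using supp S(1) by blast
  have "shift_by w ` T \<subseteq> - square_box (4 * n)"
  proof (rule image_subsetI, rule ComplI)
    fix x assume "x \<in> T" "shift_by w x \<in> square_box (4 * n)"
    then have "x \<in> T \<inter> shift_by v ` square_box (4 * n)" by (metis IntI image_eqI inv(2))
    then show False using T(2) by blast
  qed
  then have 2: "supported_in (- square_box (4 * n)) (pull B)" using supp T(1) by blast
  have "prob (pull A \<inter> pull B) - prob (pull A) * prob (pull B) \<le> r n"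
    using decoupling[OF n sets[OF A] sets[OF B] 1 2] covariance_indicator[OF sets[OF A] sets[OF B]]
    by simp
  moreover have "pull A \<inter> pull B = pull (A \<inter> B)" by (auto simp: pull_def)
  ultimately show ?thesis
    using prob_shift[OF A, of w] prob_shift[OF B, of w] prob_shift[of "A \<inter> B" w] A B
    by (simp add: pull_def)
qed

end

subsection \<open>Renormalization\<close>

definition side :: "nat \<Rightarrow> nat \<Rightarrow> nat" where
  "side n k = n * 16 ^ k"

text \<open>Boxes are closed, so neighbouring cells share a face. The point \<open>z\<close> is an
  index: the lower left corner of the cell is \<open>z\<close> times the side length.\<close>

definition cell :: "nat \<Rightarrow> nat \<Rightarrow> vertex \<Rightarrow> vertex set" where
  "cell n k z = {fst z * int (side n k)..(fst z + 1) * int (side n k)} \<times>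
                {snd z * int (side n k)..(snd z + 1) * int (side n k)}"

definition region :: "nat \<Rightarrow> nat \<Rightarrow> vertex \<Rightarrow> vertex set" where
  "region n k z = {(fst z - 1) * int (side n k)..(fst z + 2) * int (side n k)} \<times>
                  {(snd z - 1) * int (side n k)..(snd z + 2) * int (side n k)}"

definition children :: "vertex \<Rightarrow> vertex set" where
  "children z = {16 * fst z..16 * fst z + 15} \<times> {16 * snd z..16 * snd z + 15}"

text \<open>Indices of the cells at the next smaller scale that \<open>locate\<close> can assign to
  points of \<open>region\<close>. The upper end 32 is attained on the closed upper faces, hence 49
  values per coordinate.\<close>

definition nearby :: "vertex \<Rightarrow> vertex set" where
  "nearby z = {16 * fst z - 16..16 * fst z + 32} \<times> {16 * snd z - 16..16 * snd z + 32}"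

text \<open>The threshold 7 is the least that separates \<open>region t\<close> from the box of
  radius four sides about the corner of cell \<open>s\<close>: at offset -6 the two would touch. It
  also leaves room for three pairwise far rows, 0, 7 and 14, among 16.\<close>

definition far :: "vertex \<Rightarrow> vertex \<Rightarrow> bool" where
  "far s t \<longleftrightarrow> \<bar>fst s - fst t\<bar> \<ge> 7 \<or> \<bar>snd s - snd t\<bar> \<ge> 7"

lemma card_nearby: "card (nearby z) = 2401"
  by (simp add: nearby_def card_cartesian_product)

lemma children_subset_nearby: "children z \<subseteq> nearby z"
  by (auto simp: children_def nearby_def)

lemma side_Suc: "side n (Suc k) = 16 * side n k"
  by (simp only: side_def power_Suc mult.left_commute)

lemma side_pos: "n \<ge> 1 \<Longrightarrow> side n k \<ge> 1"
  by (simp add: side_def)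

lemma shift_square_box:
  "shift_by v ` square_box m = {fst v - int m..fst v + int m} \<times> {snd v - int m..snd v + int m}"
    (is "_ = ?R")
proof (intro equalityI subsetI)
  fix x assume "x \<in> ?R"
  then have "(fst x - fst v, snd x - snd v) \<in> square_box m"
    by (simp add: square_box_def mem_Times_iff)
  moreover have "x = shift_by v (fst x - fst v, snd x - snd v)" by (simp add: shift_by_def)
  ultimately show "x \<in> shift_by v ` square_box m" by (rule rev_image_eqI)
next
  fix x assume "x \<in> shift_by v ` square_box m"
  then obtain a b where "x = (a + fst v, b + snd v)" "(a, b) \<in> square_box m"
    by (auto simp: shift_by_def)
  then show "x \<in> ?R" by (simp add: square_box_def)
qed

lemma region_subset_box:
  "region n k z \<subseteq> shift_by (fst z * int (side n k), snd z * int (side n k)) ` square_box (3 * side n k)"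
  unfolding shift_square_box region_def by (auto simp: algebra_simps)

lemma far_aux:
  fixes a b L x :: int
  assumes "\<bar>a - b\<bar> \<ge> 7" "L \<ge> 1" "(b - 1) * L \<le> x" "x \<le> (b + 2) * L"
  shows "\<not> (a * L - 4 * L \<le> x \<and> x \<le> a * L + 4 * L)"
proof -
  consider "b \<ge> a + 7" | "b \<le> a - 7" using assms(1) by linarith
  then show ?thesis
  proof cases
    case 1
    then have "(a + 7) * L \<le> b * L" using assms(2) by (intro mult_right_mono) auto
    then show ?thesis using assms by (simp add: algebra_simps)
  next
    case 2
    then have "b * L \<le> (a - 7) * L" using assms(2) by (intro mult_right_mono) auto
    then show ?thesis using assms by (simp add: algebra_simps)
  qed
qed

lemma far_region_disjoint:
  assumes "far s t" "n \<ge> 1"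
  shows "region n k t \<inter> shift_by (fst s * int (side n k), snd s * int (side n k)) ` square_box (4 * side n k) = {}"
proof -
  have L: "int (side n k) \<ge> 1" using side_pos[OF assms(2), of k] by linarith
  show ?thesis
    using assms(1) far_aux[OF _ L] unfolding far_def shift_square_box region_def by fastforce
qed

text \<open>The number \<open>2401\<^sup>2\<close> of pairs of boxes near a given one is the constant of the
  recursion \<open>q (k+1) \<le> 2401\<^sup>2 (q k\<^sup>2 + r (side n k))\<close>; the two thresholds make it contract.\<close>

lemma (in decoupled_percolation) multiscale_bound:
  fixes A :: "nat \<Rightarrow> vertex \<Rightarrow> config set"
  assumes n: "n \<ge> 1"
    and sets: "\<And>k z. A k z \<in> sets config_space"
    and supp: "\<And>k z. supported_in (region n k z) (A k z)"
    and cascade: "\<And>k z \<omega>. \<omega> \<in> A (Suc k) z \<Longrightarrow>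
          \<exists>s\<in>nearby z. \<exists>t\<in>nearby z. far s t \<and> \<omega> \<in> A k s \<and> \<omega> \<in> A k t"
    and init: "\<And>z. prob (A 0 z) \<le> 1 / (4 * 2401^2)"
    and small: "\<And>k. (\<Sum>i<k. r (side n i)) \<le> 1 / (4 * (2401^2)^2)"
  shows "\<exists>u. (\<forall>k z. prob (A k z) \<le> u k) \<and> summable u \<and> suminf u \<le> 1 / 2401^2"
proof -
  define K :: real where "K = 2401^2"
  \<comment> \<open>A linear majorant of the quadratic recursion: as long as
    \<open>K * u k <= 1 / 2\<close>, the term \<open>K * (u k)^2\<close> is at most
    \<open>u k / 2\<close>.\<close>
  define u where "u = rec_nat (1 / (4 * K)) (\<lambda>k x. x / 2 + K * r (side n k))"
  have u0: "u 0 = 1 / (4 * K)" and uS: "u (Suc k) = u k / 2 + K * r (side n k)" for k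
    by (simp_all add: u_def)
  have K: "K > 0" by (simp add: K_def)
  have r0: "r (side n k) \<ge> 0" for k using r_nonneg side_pos[OF n] by blast
  have halves: "1 / (2 * K) = 1 / (4 * K) + 1 / (4 * K)" using K by (simp add: field_simps)
  have quarters: "1 / K = 4 * (1 / (4 * K))" by simp
  have u_nonneg: "u k \<ge> 0" for k
    by (induction k) (use K r0 in \<open>simp_all add: u0 uS\<close>)
  have small': "K * (\<Sum>i<k. r (side n i)) \<le> 1 / (4 * K)" for k
  proof -
    have "K * (\<Sum>i<k. r (side n i)) \<le> K * (1 / (4 * K^2))"
      using small[of k] K unfolding K_def by (intro mult_left_mono) auto
    also have "\<dots> = 1 / (4 * K)" using K by (simp add: power2_eq_square)
    finally show ?thesis .
  qed
  \<comment> \<open>Dropping the factor \<open>1 / 2\<close> in the recursion still gives a uniform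
    bound, and this bound is what keeps \<open>K * u k <= 1 / 2\<close>.\<close>
  have "u k \<le> 1 / (4 * K) + K * (\<Sum>i<k. r (side n i))" for k
  proof (induction k)
    case (Suc k)
    then show ?case using u_nonneg[of k] by (simp add: uS algebra_simps)
  qed (simp add: u0)
  then have u_le: "u k \<le> 1 / (2 * K)" for k
    using small'[of k] unfolding halves by (rule order_trans[OF _ add_left_mono])
  have main: "prob (A k z) \<le> u k" for k z
  proof (induction k arbitrary: z)
    case 0
    then show ?case using init by (simp add: u0 K_def)
  next
    case (Suc k)
    \<comment> \<open>The cascade puts the bad event inside a union over far pairs; each pair is
      decoupled with the first box at the centre.\<close>
    define I where "I = {p \<in> nearby z \<times> nearby z. far (fst p) (snd p)}"
    have fin: "finite (nearby z)" by (simp add: nearby_def)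
    then have finI: "finite I" by (simp add: I_def)
    have "card I \<le> card (nearby z \<times> nearby z)"
      unfolding I_def using fin by (intro card_mono) auto
    then have "real (card I) \<le> real (2401 * 2401)"
      unfolding card_cartesian_product card_nearby by (simp only: of_nat_le_iff)
    then have cardI: "real (card I) \<le> K" by (simp add: K_def)
    have step: "prob (A k (fst p) \<inter> A k (snd p)) \<le> u k * u k + r (side n k)" if "p \<in> I" for p
    proof -
      have "prob (A k (fst p) \<inter> A k (snd p)) \<le> prob (A k (fst p)) * prob (A k (snd p)) + r (side n k)"
        using that far_region_disjoint[OF _ n] unfolding I_def
        by (intro decoupling_shift[OF side_pos[OF n] sets sets supp region_subset_box supp]) auto
      also have "prob (A k (fst p)) * prob (A k (snd p)) \<le> u k * u k"
        using Suc u_nonneg by (intro mult_mono) auto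
      finally show ?thesis by simp
    qed
    have "prob (A (Suc k) z) \<le> prob (\<Union>p\<in>I. A k (fst p) \<inter> A k (snd p))"
    proof (rule finite_measure_mono)
      show "A (Suc k) z \<subseteq> (\<Union>p\<in>I. A k (fst p) \<inter> A k (snd p))"
        using cascade unfolding I_def by fastforce
    qed (use sets finI in auto)
    also have "\<dots> \<le> (\<Sum>p\<in>I. prob (A k (fst p) \<inter> A k (snd p)))"
      using sets finI by (intro finite_measure_subadditive_finite) auto
    also have "\<dots> \<le> real (card I) * (u k * u k + r (side n k))"
      using step by (intro sum_bounded_above) auto
    also have "\<dots> \<le> K * (u k * u k + r (side n k))"
      using cardI r0 u_nonneg by (intro mult_right_mono) auto
    also have "\<dots> = (K * u k) * u k + K * r (side n k)" by (simp add: algebra_simps)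
    also have "(K * u k) * u k \<le> 1 / 2 * u k"
      using u_le[of k] K u_nonneg by (intro mult_right_mono) (auto simp: field_simps)
    finally show ?case by (simp add: uS)
  qed
  \<comment> \<open>Counting the last term twice makes the induction exact: passing to
    \<open>Suc k\<close> adds \<open>2 * u (Suc k) - u k\<close>, which equals
    \<open>2 * K * r (side n k)\<close>.\<close>
  have *: "(\<Sum>i<Suc k. u i) + u k \<le> 2 * (1 / (4 * K)) + 2 * (K * (\<Sum>i<k. r (side n i)))" for k
  proof (induction k)
    case (Suc k)
    then show ?case by (simp add: uS algebra_simps)
  qed (simp add: u0)
  have psum: "(\<Sum>i<Suc k. u i) \<le> 1 / K" for k
  proof -
    have "(\<Sum>i<Suc k. u i) \<le> 2 * (1 / (4 * K)) + 2 * (1 / (4 * K))"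
      using * [of k] small'[of k] u_nonneg[of k] by linarith
    then show ?thesis using quarters by linarith
  qed
  have psum': "(\<Sum>i<k. u i) \<le> 1 / K" for k
    using psum[of k] u_nonneg[of k] by simp
  have "summable u"
    using u_nonneg psum' by (intro summableI_nonneg_bounded) auto
  moreover have "suminf u \<le> 1 / K"
    using \<open>summable u\<close> psum' by (intro suminf_le_const) auto
  ultimately show ?thesis using main unfolding K_def by blast
qed

section \<open>Geometry of cells and regions\<close>

lemma cell_subset_region: "cell n k z \<subseteq> region n k z"
  unfolding cell_def region_def by (auto simp: algebra_simps)

lemma finite_region: "finite (region n k z)"
  by (simp add: region_def)

lemma region_child_subset:
  assumes "s \<in> children z"
  shows "region n k s \<subseteq> region n (Suc k) z"
proof -
  have *: "(16 * a - 16) * int (side n k) \<le> (b - 1) * int (side n k)"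
    "(b + 2) * int (side n k) \<le> (16 * a + 32) * int (side n k)"
    if "16 * a \<le> b" "b \<le> 16 * a + 15" for a b :: int
    using that by (intro mult_right_mono; simp)+
  have 1: "(16 * a - 16) * int (side n k) = (a - 1) * int (side n (Suc k))"
    "(16 * a + 32) * int (side n k) = (a + 2) * int (side n (Suc k))" for a
    by (simp_all add: side_Suc algebra_simps)
  have "16 * fst z \<le> fst s" "fst s \<le> 16 * fst z + 15" "16 * snd z \<le> snd s" "snd s \<le> 16 * snd z + 15"
    using assms by (auto simp: children_def)
  note bounds = *[OF this(1,2), unfolded 1] *[OF this(3,4), unfolded 1]
  show ?thesis
    using bounds unfolding region_def subset_iff mem_Times_iff fst_conv snd_conv atLeastAtMost_iff
    by (meson order_trans)
qed

text \<open>Division rounds down, so a point on a shared face is assigned to the cell with the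
  larger index.\<close>

definition locate :: "nat \<Rightarrow> nat \<Rightarrow> vertex \<Rightarrow> vertex" where
  "locate n k x = (fst x div int (side n k), snd x div int (side n k))"

lemma div_bounds:
  fixes a b x L :: int
  assumes "L \<ge> 1"
  shows "a * L \<le> x \<Longrightarrow> a \<le> x div L" "x \<le> b * L \<Longrightarrow> x div L \<le> b"
proof -
  show "a \<le> x div L" if "a * L \<le> x"
    using zdiv_mono1[OF that, of L] assms by simp
  show "x div L \<le> b" if "x \<le> b * L"
    using zdiv_mono1[OF that, of L] assms by simp
qed

lemma in_cell_locate:
  assumes "n \<ge> 1"
  shows "x \<in> cell n k (locate n k x)"
proof -
  have L: "int (side n k) > 0" using side_pos[OF assms, of k] by linarith
  have "a div int (side n k) * int (side n k) \<le> a \<and> a \<le> (a div int (side n k) + 1) * int (side n k)" for a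
    using pos_mod_sign[OF L, of a] pos_mod_bound[OF L, of a] div_mult_mod_eq[of a "int (side n k)"]
    by (simp only: distrib_right) linarith
  then show ?thesis by (simp add: cell_def locate_def mem_Times_iff)
qed

text \<open>Points of \<open>region n k s\<close> have indices between \<open>s - 1\<close> and
  \<open>s + 2\<close> in each coordinate, which is well within distance 7.\<close>

lemma far_locate_outside:
  assumes "n \<ge> 1" "far s (locate n k w)"
  shows "w \<notin> region n k s"
proof
  assume "w \<in> region n k s"
  have L: "int (side n k) \<ge> 1" using side_pos[OF assms(1), of k] by linarith
  from \<open>w \<in> region n k s\<close> have "fst s - 1 \<le> fst (locate n k w)" "fst (locate n k w) \<le> fst s + 2"
    "snd s - 1 \<le> snd (locate n k w)" "snd (locate n k w) \<le> snd s + 2"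
    unfolding region_def locate_def by (auto intro!: div_bounds[OF L])
  then show False using assms(2) unfolding far_def by linarith
qed

lemma rim_region:
  assumes "w \<in> rim (region n k z)"
  shows "fst w = (fst z - 1) * int (side n k) \<or> fst w = (fst z + 2) * int (side n k) \<or>
         snd w = (snd z - 1) * int (side n k) \<or> snd w = (snd z + 2) * int (side n k)"
proof -
  obtain a b where w: "w = (a, b)" by (cases w)
  from assms obtain v where "{w, v} \<in> edges" "v \<notin> region n k z" by (auto simp: rim_def)
  moreover obtain c d where "v = (c, d)" by (cases v)
  moreover have "w \<in> region n k z" using assms by (simp add: rim_def)
  ultimately show ?thesis using w by (auto simp: edge_iff region_def)
qed

lemma region_shift:
  "region n k z = shift_by (fst z * int (side n k), snd z * int (side n k)) ` region n k (0, 0)"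
    (is "_ = shift_by ?v ` _")
proof -
  have "(x, y) \<in> shift_by ?v ` region n k (0, 0)" if "(x, y) \<in> region n k z" for x y
    using that
    by (intro image_eqI[of _ _ "(x - fst ?v, y - snd ?v)"])
      (auto simp: shift_by_def region_def algebra_simps)
  moreover have "shift_by ?v x \<in> region n k z" if "x \<in> region n k (0, 0)" for x
    using that by (auto simp: shift_by_def region_def algebra_simps)
  ultimately show ?thesis by auto
qed

section \<open>The events that start the recursion\<close>

definition some_open :: "vertex set \<Rightarrow> config set" where
  "some_open S = {\<omega> \<in> space config_space. \<exists>e\<in>edges. e \<subseteq> S \<and> \<omega> e}"

definition all_open :: "vertex set \<Rightarrow> config set" where
  "all_open S = {\<omega> \<in> space config_space. \<forall>e\<in>edges. e \<subseteq> S \<longrightarrow> \<omega> e}"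

lemma sets_some_open: "finite S \<Longrightarrow> some_open S \<in> sets config_space"
  and sets_all_open: "finite S \<Longrightarrow> all_open S \<in> sets config_space"
proof -
  assume S: "finite S"
  define F where "F = {e \<in> edges. e \<subseteq> S}"
  have F: "finite F" unfolding F_def by (rule finite_subset[of _ "Pow S"]) (use S in auto)
  have [measurable]: "\<And>e. e \<in> F \<Longrightarrow> Measurable.pred config_space (\<lambda>\<omega>. \<omega> e)"
    by (rule measurable_edge_state) (simp add: F_def)
  have "some_open S = {\<omega> \<in> space config_space. \<exists>e\<in>F. \<omega> e}" by (auto simp: some_open_def F_def)
  then show "some_open S \<in> sets config_space" using F by simp
  have "all_open S = {\<omega> \<in> space config_space. \<forall>e\<in>F. \<omega> e}" by (auto simp: all_open_def F_def)
  then show "all_open S \<in> sets config_space" using F by simp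
qed

text \<open>These are the conditions under which the limits at parameters 0 and 1 are assumed. The
  edge \<open>e\<close> prevents triviality: the all-open and all-closed configurations then differ
  on \<open>A\<close>.\<close>

lemma open_events_finitary:
  assumes "finite S" "e \<in> edges" "e \<subseteq> S" and A: "A = some_open S \<or> A = all_open S"
  shows "increasing_event A" "finitely_supported A" "nontrivial_event A"
proof -
  show "increasing_event A"
    unfolding increasing_event_def
  proof (intro conjI ballI impI)
    show "A \<in> sets config_space" using A assms(1) sets_some_open sets_all_open by blast
    show "\<omega>' \<in> A" if "\<omega> \<in> A" "\<omega>' \<in> space config_space" "\<forall>e\<in>edges. \<omega> e \<le> \<omega>' e" for \<omega> \<omega>'
      using A that unfolding some_open_def all_open_def le_bool_def by blast
  qed
  define F where "F = {e \<in> edges. e \<subseteq> S}"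
  have "finite F" unfolding F_def by (rule finite_subset[of _ "Pow S"]) (use assms in auto)
  moreover have "depends_only_on F A"
    unfolding depends_only_on_def
  proof (intro ballI impI)
    fix \<omega> \<omega>' assume sp: "\<omega> \<in> space config_space" "\<omega>' \<in> space config_space"
      and "\<forall>e\<in>F. \<omega> e = \<omega>' e"
    then have "(\<exists>e\<in>edges. e \<subseteq> S \<and> \<omega> e) \<longleftrightarrow> (\<exists>e\<in>edges. e \<subseteq> S \<and> \<omega>' e)"
      "(\<forall>e\<in>edges. e \<subseteq> S \<longrightarrow> \<omega> e) \<longleftrightarrow> (\<forall>e\<in>edges. e \<subseteq> S \<longrightarrow> \<omega>' e)"
      unfolding F_def by blast+
    then show "\<omega> \<in> A \<longleftrightarrow> \<omega>' \<in> A"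
      using A sp by (elim disjE) (simp_all add: some_open_def all_open_def)
  qed
  moreover have "F \<subseteq> edges" by (auto simp: F_def)
  ultimately show "finitely_supported A" unfolding finitely_supported_def by blast
  have "(\<lambda>e\<in>edges. b) \<in> space config_space" for b
    by (simp add: config_space_def space_PiM)
  then have "(\<lambda>e\<in>edges. True) \<in> A" "(\<lambda>e\<in>edges. False) \<in> space config_space - A"
    using A assms by (auto simp: some_open_def all_open_def)
  then show "nontrivial_event A" unfolding nontrivial_event_def by blast
qed

context decoupled_percolation
begin

lemma prob_some_open_shift:
  assumes "finite S"
  shows "prob (some_open (shift_by v ` S)) = prob (some_open S)"
proof -
  have "some_open (shift_by v ` S) = config_map (shift_by v) -` some_open S \<inter> space config_space"
  proof -
    have "(\<exists>e\<in>edges. e \<subseteq> shift_by v ` S \<and> \<omega> e) \<longleftrightarrow> (\<exists>e\<in>edges. e \<subseteq> S \<and> \<omega> (shift_by v ` e))" for \<omega>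
      using shift_image_edge by (metis (no_types, lifting) subset_image_iff)
    then show ?thesis
      using measurable_space[OF measurable_config_map_shift[of v]]
      by (auto simp: some_open_def config_map_def)
  qed
  then show ?thesis using prob_shift sets_some_open[OF assms] by simp
qed

lemma prob_all_open_shift:
  assumes "finite S"
  shows "prob (all_open (shift_by v ` S)) = prob (all_open S)"
proof -
  have "all_open (shift_by v ` S) = config_map (shift_by v) -` all_open S \<inter> space config_space"
  proof -
    have "(\<forall>e\<in>edges. e \<subseteq> shift_by v ` S \<longrightarrow> \<omega> e) \<longleftrightarrow> (\<forall>e\<in>edges. e \<subseteq> S \<longrightarrow> \<omega> (shift_by v ` e))" for \<omega>
      using shift_image_edge by (metis (no_types, lifting) subset_image_iff)
    then show ?thesis
      using measurable_space[OF measurable_config_map_shift[of v]]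
      by (auto simp: all_open_def config_map_def)
  qed
  then show ?thesis using prob_shift sets_all_open[OF assms] by simp
qed

end

subsection \<open>Absence of percolation\<close>

definition crosses :: "nat \<Rightarrow> nat \<Rightarrow> vertex \<Rightarrow> config set" where
  "crosses n k z = {\<omega> \<in> space config_space.
     \<exists>x\<in>cell n k z. \<exists>w\<in>rim (region n k z). (x, w) \<in> conn (region n k z) \<omega>}"

lemma sets_crosses: "crosses n k z \<in> sets config_space"
  unfolding crosses_def Bex_def by measurable

lemma supported_crosses: "supported_in (region n k z) (crosses n k z)"
  unfolding supported_in_def depends_only_on_def
proof (intro ballI impI)
  fix \<omega> \<omega>' assume "\<omega> \<in> space config_space" "\<omega>' \<in> space config_space"
    and "\<forall>e\<in>{e \<in> edges. e \<subseteq> region n k z}. \<omega> e = \<omega>' e"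
  moreover from this have "conn (region n k z) \<omega> = conn (region n k z) \<omega>'"
    by (intro conn_cong) auto
  ultimately show "\<omega> \<in> crosses n k z \<longleftrightarrow> \<omega>' \<in> crosses n k z"
    by (simp add: crosses_def)
qed

lemma crossesI:
  assumes "n \<ge> 1" "\<omega> \<in> space config_space" "(x, y) \<in> conn UNIV \<omega>"
    and "y \<notin> region n k (locate n k x)"
  shows "\<omega> \<in> crosses n k (locate n k x)"
  using in_cell_locate[OF assms(1), of x k] conn_reaches_rim[OF assms(3) _ assms(4)]
    cell_subset_region assms(2) unfolding crosses_def by blast

text \<open>The two ends of the crossing lie in cells of the smaller scale whose indices differ by
  at least 16 in some coordinate. Each end is outside the region around the other, so the same path
  crosses both small regions.\<close>

lemma crosses_cascade:
  assumes n: "n \<ge> 1" and \<omega>: "\<omega> \<in> crosses n (Suc k) z"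
  shows "\<exists>s\<in>nearby z. \<exists>t\<in>nearby z. far s t \<and> \<omega> \<in> crosses n k s \<and> \<omega> \<in> crosses n k t"
proof -
  have L: "int (side n k) \<ge> 1" using side_pos[OF n, of k] by linarith
  obtain x w where x: "x \<in> cell n (Suc k) z" and w: "w \<in> rim (region n (Suc k) z)"
    and xw: "(x, w) \<in> conn UNIV \<omega>" and sp: "\<omega> \<in> space config_space"
    using \<omega> conn_mono[of _ UNIV] unfolding crosses_def by blast
  define s t where "s = locate n k x" and "t = locate n k w"
  have 1: "a * int (side n (Suc k)) = (16 * a) * int (side n k)" for a
    by (simp add: side_Suc)
  have s: "16 * fst z \<le> fst s" "fst s \<le> 16 * fst z + 16" "16 * snd z \<le> snd s" "snd s \<le> 16 * snd z + 16"
    using x unfolding cell_def s_def locate_def 1 by (auto intro!: div_bounds[OF L])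
  have "w \<in> region n (Suc k) z" using w by (simp add: rim_def)
  then have t: "16 * fst z - 16 \<le> fst t" "fst t \<le> 16 * fst z + 32"
    "16 * snd z - 16 \<le> snd t" "snd t \<le> 16 * snd z + 32"
    unfolding region_def t_def locate_def 1 by (auto intro!: div_bounds[OF L])
  \<comment> \<open>The rim point has an extreme coordinate, and this coordinate is an exact
    multiple of the smaller side, so the division is exact.\<close>
  have "fst t = 16 * fst z - 16 \<or> fst t = 16 * fst z + 32 \<or>
      snd t = 16 * snd z - 16 \<or> snd t = 16 * snd z + 32"
    using rim_region[OF w] L unfolding t_def locate_def 1 by auto
  then have far: "far s t" using s unfolding far_def by linarith
  then have far': "far t s" unfolding far_def by linarith
  have "\<omega> \<in> crosses n k s"
    using crossesI[OF n sp xw] far_locate_outside[OF n] far unfolding s_def t_def by blast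
  moreover have "\<omega> \<in> crosses n k t"
    using crossesI[OF n sp conn_sym[OF xw]] far_locate_outside[OF n] far' unfolding s_def t_def by blast
  moreover have "s \<in> nearby z" "t \<in> nearby z"
    using s t by (auto simp: nearby_def mem_Times_iff)
  ultimately show ?thesis using far by blast
qed

text \<open>The cell and the rim of its region are disjoint, so a crossing contains at least one
  open edge.\<close>

lemma crosses_subset_some_open:
  assumes "n \<ge> 1"
  shows "crosses n k z \<subseteq> some_open (region n k z)"
proof
  fix \<omega> assume "\<omega> \<in> crosses n k z"
  then obtain x w where x: "x \<in> cell n k z" and w: "w \<in> rim (region n k z)"
    and xw: "(x, w) \<in> conn (region n k z) \<omega>" and sp: "\<omega> \<in> space config_space"
    unfolding crosses_def by blast
  have "x \<noteq> w"
    using rim_region[OF w] x side_pos[OF assms, of k] by (auto simp: cell_def algebra_simps)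
  then show "\<omega> \<in> some_open (region n k z)"
    using conn_open_edge[OF xw] sp by (auto simp: some_open_def)
qed

lemma origin_to_infinity_crosses:
  assumes "n \<ge> 1"
  shows "origin_to_infinity \<subseteq> crosses n k (0, 0)"
proof
  fix \<omega> assume \<omega>: "\<omega> \<in> origin_to_infinity"
  then have "\<not> cluster \<omega> (0, 0) \<subseteq> region n k (0, 0)"
    using finite_subset[OF _ finite_region] unfolding origin_to_infinity_def by blast
  then obtain y where "((0, 0), y) \<in> conn UNIV \<omega>" "y \<notin> region n k (0, 0)"
    unfolding cluster_conn by blast
  then show "\<omega> \<in> crosses n k (0, 0)"
    using crossesI[OF assms, of \<omega> "(0, 0)" y k] \<omega> by (simp add: locate_def origin_to_infinity_def)
qed

text \<open>Percolation forces a crossing at every scale, and the crossing probabilities are bounded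
  by the terms of a convergent series, which tend to 0.\<close>

lemma (in decoupled_percolation) no_percolation:
  assumes n: "n \<ge> 1"
    and init: "prob (some_open (region n 0 (0, 0))) \<le> 1 / (4 * 2401^2)"
    and small: "\<And>k. (\<Sum>i<k. r (side n i)) \<le> 1 / (4 * (2401^2)^2)"
  shows "prob origin_to_infinity = 0"
proof -
  have init': "prob (crosses n 0 z) \<le> 1 / (4 * 2401^2)" for z
  proof -
    have "prob (crosses n 0 z) \<le> prob (some_open (region n 0 z))"
      using crosses_subset_some_open[OF n] sets_some_open[OF finite_region]
      by (intro finite_measure_mono) auto
    also have "\<dots> = prob (some_open (region n 0 (0, 0)))"
      by (subst region_shift) (rule prob_some_open_shift[OF finite_region])
    finally show ?thesis using init by linarith
  qed
  obtain u where u: "\<And>k z. prob (crosses n k z) \<le> u k" "summable u"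
    using multiscale_bound[OF n sets_crosses supported_crosses crosses_cascade[OF n] init' small]
    by blast
  have "prob origin_to_infinity \<le> u k" for k
  proof -
    have "prob origin_to_infinity \<le> prob (crosses n k (0, 0))"
      using sets_crosses by (intro finite_measure_mono origin_to_infinity_crosses[OF n]) simp
    then show ?thesis using u(1)[of k "(0, 0)"] by linarith
  qed
  then have "prob origin_to_infinity \<le> 0"
    using summable_LIMSEQ_zero[OF u(2)] by (intro LIMSEQ_le_const) auto
  then show ?thesis using measure_nonneg[of M origin_to_infinity] by linarith
qed

subsection \<open>Percolation\<close>

text \<open>Equivalently at positive scales, all bad children fit into one block of 7 by 7. Only
  children are inspected, which keeps the event supported in \<open>region n k z\<close>.\<close>

fun good :: "nat \<Rightarrow> nat \<Rightarrow> vertex \<Rightarrow> config \<Rightarrow> bool" where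
  "good n 0 z \<omega> \<longleftrightarrow> (\<forall>e\<in>edges. e \<subseteq> region n 0 z \<longrightarrow> \<omega> e)"
| "good n (Suc k) z \<omega> \<longleftrightarrow>
     (\<forall>s\<in>children z. \<forall>t\<in>children z. far s t \<longrightarrow> good n k s \<omega> \<or> good n k t \<omega>)"

definition good_row :: "nat \<Rightarrow> nat \<Rightarrow> vertex \<Rightarrow> config \<Rightarrow> int \<Rightarrow> bool" where
  "good_row n k z \<omega> j \<longleftrightarrow> (\<forall>i\<in>{16 * fst z..16 * fst z + 15}. good n k (i, j) \<omega>)"

definition good_column :: "nat \<Rightarrow> nat \<Rightarrow> vertex \<Rightarrow> config \<Rightarrow> int \<Rightarrow> bool" where
  "good_column n k z \<omega> i \<longleftrightarrow> (\<forall>j\<in>{16 * snd z..16 * snd z + 15}. good n k (i, j) \<omega>)"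

text \<open>Discarding the children that lie neither in a good row nor in a good column keeps the rest
  connected: every good row meets every good column.\<close>

fun core :: "nat \<Rightarrow> nat \<Rightarrow> vertex \<Rightarrow> config \<Rightarrow> vertex set" where
  "core n 0 z \<omega> = region n 0 z"
| "core n (Suc k) z \<omega> = (\<Union>s\<in>{s \<in> children z. good_row n k z \<omega> (snd s) \<or> good_column n k z \<omega> (fst s)}.
     core n k s \<omega>)"

lemma core_subset_region: "core n k z \<omega> \<subseteq> region n k z"
proof (induction k arbitrary: z)
  case (Suc k)
  then show ?case unfolding core.simps using region_child_subset by blast
qed simp

text \<open>A bad child in each of two rows at distance at least 7 would form a far pair, whatever
  their columns.\<close>

lemma good_row_or:
  assumes "good n (Suc k) z \<omega>" "j \<in> {16 * snd z..16 * snd z + 15}" "j' \<in> {16 * snd z..16 * snd z + 15}"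
    and "\<bar>j - j'\<bar> \<ge> 7"
  shows "good_row n k z \<omega> j \<or> good_row n k z \<omega> j'"
proof (rule ccontr)
  assume "\<not> ?thesis"
  then obtain i i' where "i \<in> {16 * fst z..16 * fst z + 15}" "\<not> good n k (i, j) \<omega>"
    "i' \<in> {16 * fst z..16 * fst z + 15}" "\<not> good n k (i', j') \<omega>"
    unfolding good_row_def by blast
  moreover from this have "(i, j) \<in> children z" "(i', j') \<in> children z" "far (i, j) (i', j')"
    using assms unfolding children_def far_def by auto
  ultimately show False using assms(1) by auto
qed

lemma good_column_or:
  assumes "good n (Suc k) z \<omega>" "i \<in> {16 * fst z..16 * fst z + 15}" "i' \<in> {16 * fst z..16 * fst z + 15}"
    and "\<bar>i - i'\<bar> \<ge> 7"
  shows "good_column n k z \<omega> i \<or> good_column n k z \<omega> i'"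
proof (rule ccontr)
  assume "\<not> ?thesis"
  then obtain j j' where "j \<in> {16 * snd z..16 * snd z + 15}" "\<not> good n k (i, j) \<omega>"
    "j' \<in> {16 * snd z..16 * snd z + 15}" "\<not> good n k (i', j') \<omega>"
    unfolding good_column_def by blast
  moreover from this have "(i, j) \<in> children z" "(i', j') \<in> children z" "far (i, j) (i', j')"
    using assms unfolding children_def far_def by auto
  ultimately show False using assms(1) by auto
qed

text \<open>Of the rows \<open>0\<close>, \<open>7\<close>, \<open>14\<close> each box spoils at most one, so two boxes have a common good one.\<close>

lemma common_good_row:
  assumes "good n (Suc k) z \<omega>" "good n (Suc k) z' \<omega>" "snd z' = snd z"
  obtains j where "j \<in> {16 * snd z..16 * snd z + 15}" "good_row n k z \<omega> j" "good_row n k z' \<omega> j"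
proof -
  define a where "a = 16 * snd z"
  have a: "a \<in> {16 * snd z..16 * snd z + 15}" "a + 7 \<in> {16 * snd z..16 * snd z + 15}"
    "a + 14 \<in> {16 * snd z..16 * snd z + 15}"
    by (auto simp: a_def)
  note R = good_row_or[OF assms(1)] and R' = good_row_or[OF assms(2), unfolded assms(3)]
  have "(good_row n k z \<omega> a \<and> good_row n k z' \<omega> a) \<or>
      (good_row n k z \<omega> (a + 7) \<and> good_row n k z' \<omega> (a + 7)) \<or>
      (good_row n k z \<omega> (a + 14) \<and> good_row n k z' \<omega> (a + 14))"
    using R[OF a(1,2)] R[OF a(1,3)] R[OF a(2,3)] R'[OF a(1,2)] R'[OF a(1,3)] R'[OF a(2,3)]
    by simp blast
  then show ?thesis using that a by blast
qed

lemma common_good_column: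
  assumes "good n (Suc k) z \<omega>" "good n (Suc k) z' \<omega>" "fst z' = fst z"
  obtains i where "i \<in> {16 * fst z..16 * fst z + 15}" "good_column n k z \<omega> i" "good_column n k z' \<omega> i"
proof -
  define a where "a = 16 * fst z"
  have a: "a \<in> {16 * fst z..16 * fst z + 15}" "a + 7 \<in> {16 * fst z..16 * fst z + 15}"
    "a + 14 \<in> {16 * fst z..16 * fst z + 15}"
    by (auto simp: a_def)
  note R = good_column_or[OF assms(1)] and R' = good_column_or[OF assms(2), unfolded assms(3)]
  have "(good_column n k z \<omega> a \<and> good_column n k z' \<omega> a) \<or>
      (good_column n k z \<omega> (a + 7) \<and> good_column n k z' \<omega> (a + 7)) \<or>
      (good_column n k z \<omega> (a + 14) \<and> good_column n k z' \<omega> (a + 14))"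
    using R[OF a(1,2)] R[OF a(1,3)] R[OF a(2,3)] R'[OF a(1,2)] R'[OF a(1,3)] R'[OF a(2,3)]
    by simp blast
  then show ?thesis using that a by blast
qed

text \<open>An L-shaped path, first horizontal and then vertical, stays in the rectangle.\<close>

lemma conn_open_rectangle:
  assumes op: "\<And>e. e \<in> edges \<Longrightarrow> e \<subseteq> {a..b} \<times> {c..d} \<Longrightarrow> \<omega> e"
    and "x \<in> {a..b} \<times> {c..d}" "y \<in> {a..b} \<times> {c..d :: int}"
  shows "(x, y) \<in> conn UNIV \<omega>"
proof -
  obtain x1 x2 y1 y2 where x: "x = (x1, x2)" "x1 \<in> {a..b}" "x2 \<in> {c..d}"
    and y: "y = (y1, y2)" "y1 \<in> {a..b}" "y2 \<in> {c..d}"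
    using assms(2,3) by (cases x, cases y) auto
  have "((x1, x2), (y1, x2)) \<in> conn UNIV \<omega>"
    by (rule conn_chain[where f = "\<lambda>i. (i, x2)" and a = a and b = b])
      (use x y in \<open>auto intro!: conn_edge op simp: edge_iff\<close>)
  moreover have "((y1, x2), (y1, y2)) \<in> conn UNIV \<omega>"
    by (rule conn_chain[where f = "\<lambda>j. (y1, j)" and a = c and b = d])
      (use x y in \<open>auto intro!: conn_edge op simp: edge_iff\<close>)
  ultimately show ?thesis using x y conn_trans by blast
qed

text \<open>Only rightward and upward neighbours, matching the steps from \<open>f i\<close> to
  \<open>f (i + 1)\<close> in \<open>conn_chain\<close>; the other directions follow from
  \<open>conn_sym\<close>.\<close>

definition adjacent :: "vertex \<Rightarrow> vertex \<Rightarrow> bool" where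
  "adjacent z z' \<longleftrightarrow> z' = (fst z + 1, snd z) \<or> z' = (fst z, snd z + 1)"

lemma good_row_child:
  "good_row n k z \<omega> j \<Longrightarrow> i \<in> {16 * fst z..16 * fst z + 15} \<Longrightarrow> j \<in> {16 * snd z..16 * snd z + 15} \<Longrightarrow>
     good n k (i, j) \<omega> \<and> core n k (i, j) \<omega> \<subseteq> core n (Suc k) z \<omega>"
  by (force simp: good_row_def children_def)

lemma good_column_child:
  "good_column n k z \<omega> i \<Longrightarrow> i \<in> {16 * fst z..16 * fst z + 15} \<Longrightarrow> j \<in> {16 * snd z..16 * snd z + 15} \<Longrightarrow>
     good n k (i, j) \<omega> \<and> core n k (i, j) \<omega> \<subseteq> core n (Suc k) z \<omega>"
  by (force simp: good_column_def children_def)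

text \<open>Both claims go through one induction: linking adjacent cores at scale \<open>k\<close>
  chains the children along good rows and columns, which connects the core at scale
  \<open>Suc k\<close>; linking two adjacent children across the common face joins adjacent cores
  there.\<close>

lemma core_good:
  "(\<forall>z. good n k z \<omega> \<longrightarrow> core n k z \<omega> \<noteq> {} \<and> (\<forall>x\<in>core n k z \<omega>. \<forall>y\<in>core n k z \<omega>. (x, y) \<in> conn UNIV \<omega>)) \<and>
   (\<forall>z z'. good n k z \<omega> \<longrightarrow> good n k z' \<omega> \<longrightarrow> adjacent z z' \<longrightarrow>
      (\<exists>x\<in>core n k z \<omega>. \<exists>y\<in>core n k z' \<omega>. (x, y) \<in> conn UNIV \<omega>))"
proof (induction k)
  case 0
  show ?case
  proof (intro conjI allI impI)
    fix z
    \<comment> \<open>The lower left corner of cell \<open>z\<close> lies in the regions of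
      \<open>z\<close> and of both possible \<open>z'\<close>, so at scale 0 adjacent cores
      intersect.\<close>
    have corner: "(fst z * int (side n 0), snd z * int (side n 0)) \<in> region n 0 z"
      by (simp add: region_def algebra_simps)
    then show "core n 0 z \<omega> \<noteq> {}" by auto
    show "\<forall>x\<in>core n 0 z \<omega>. \<forall>y\<in>core n 0 z \<omega>. (x, y) \<in> conn UNIV \<omega>" if "good n 0 z \<omega>"
    proof (intro ballI)
      fix x y assume "x \<in> core n 0 z \<omega>" "y \<in> core n 0 z \<omega>"
      then show "(x, y) \<in> conn UNIV \<omega>"
        using that unfolding good.simps core.simps region_def
        by (intro conn_open_rectangle[rotated]) (assumption | blast)+
    qed
    fix z' assume "adjacent z z'"
    then have "(fst z * int (side n 0), snd z * int (side n 0)) \<in> region n 0 z'"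
      by (auto simp: adjacent_def region_def algebra_simps)
    then show "\<exists>x\<in>core n 0 z \<omega>. \<exists>y\<in>core n 0 z' \<omega>. (x, y) \<in> conn UNIV \<omega>"
      using corner conn_refl unfolding core.simps by blast
  qed
next
  case (Suc k)
  have ne: "core n k z \<omega> \<noteq> {}"
    and inner: "x \<in> core n k z \<omega> \<Longrightarrow> y \<in> core n k z \<omega> \<Longrightarrow> (x, y) \<in> conn UNIV \<omega>"
    if "good n k z \<omega>" for z x y
    using Suc that by blast+
  have adj: "\<exists>x\<in>core n k z \<omega>. \<exists>y\<in>core n k z' \<omega>. (x, y) \<in> conn UNIV \<omega>"
    if "good n k z \<omega>" "good n k z' \<omega>" "adjacent z z'" for z z'
    using Suc that by blast
  \<comment> \<open>One representative vertex per core reduces connections between good boxes to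
    chains of vertices.\<close>
  define p where "p s = (SOME x. x \<in> core n k s \<omega>)" for s
  have p: "p s \<in> core n k s \<omega>" if "good n k s \<omega>" for s
    unfolding p_def using ne[OF that] some_in_eq by blast
  have p_adj: "(p s, p t) \<in> conn UNIV \<omega>" if st: "good n k s \<omega>" "good n k t \<omega>" "adjacent s t" for s t
  proof -
    obtain x y where xy: "x \<in> core n k s \<omega>" "y \<in> core n k t \<omega>" "(x, y) \<in> conn UNIV \<omega>"
      using adj[OF st] by blast
    show ?thesis
      using inner[OF st(1) p[OF st(1)] xy(1)] xy(3) inner[OF st(2) xy(2) p[OF st(2)]] conn_trans by blast
  qed
  have row: "(p (i, j), p (i', j)) \<in> conn UNIV \<omega>"
    if "good_row n k z \<omega> j" "i \<in> {16 * fst z..16 * fst z + 15}" "i' \<in> {16 * fst z..16 * fst z + 15}" for z i i' j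
    by (rule conn_chain[where f = "\<lambda>i. p (i, j)", OF p_adj that(2,3)])
      (use that(1) in \<open>auto simp: good_row_def adjacent_def\<close>)
  have column: "(p (i, j), p (i, j')) \<in> conn UNIV \<omega>"
    if "good_column n k z \<omega> i" "j \<in> {16 * snd z..16 * snd z + 15}" "j' \<in> {16 * snd z..16 * snd z + 15}" for z i j j'
    by (rule conn_chain[where f = "\<lambda>j. p (i, j)", OF p_adj that(2,3)])
      (use that(1) in \<open>auto simp: good_column_def adjacent_def\<close>)
  show ?case
  proof (intro conjI allI impI)
    fix z assume z: "good n (Suc k) z \<omega>"
    obtain j0 where j0: "j0 \<in> {16 * snd z..16 * snd z + 15}" "good_row n k z \<omega> j0"
      using common_good_row[OF z z] by blast
    obtain i0 where i0: "i0 \<in> {16 * fst z..16 * fst z + 15}" "good_column n k z \<omega> i0"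
      using common_good_column[OF z z] by blast
    show "core n (Suc k) z \<omega> \<noteq> {}"
      using good_row_child[OF j0(2) i0(1) j0(1)] ne by blast
    \<comment> \<open>The child at the crossing of a good column and a good row serves as hub:
      follow column \<open>i0\<close> to a good row, or row \<open>j0\<close> to a good column, and
      then that line to the child containing \<open>x\<close>.\<close>
    have "(p (i0, j0), x) \<in> conn UNIV \<omega>" if x_core: "x \<in> core n (Suc k) z \<omega>" for x
    proof -
      obtain s where s: "s \<in> children z" "good_row n k z \<omega> (snd s) \<or> good_column n k z \<omega> (fst s)"
        and "x \<in> core n k s \<omega>"
        using x_core by auto
      moreover obtain i j where "s = (i, j)" by (cases s)
      ultimately have ij: "i \<in> {16 * fst z..16 * fst z + 15}" "j \<in> {16 * snd z..16 * snd z + 15}"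
        "good_row n k z \<omega> j \<or> good_column n k z \<omega> i" and x: "x \<in> core n k (i, j) \<omega>"
        by (simp_all add: children_def)
      have g: "good n k (i, j) \<omega>"
        using ij good_row_child good_column_child by blast
      have "(p (i0, j0), p (i, j)) \<in> conn UNIV \<omega>"
        using ij(3)
      proof
        assume "good_row n k z \<omega> j"
        then show ?thesis using column[OF i0(2) j0(1) ij(2)] row[OF _ i0(1) ij(1)] conn_trans by blast
      next
        assume "good_column n k z \<omega> i"
        then show ?thesis using row[OF j0(2) i0(1) ij(1)] column[OF _ j0(1) ij(2)] conn_trans by blast
      qed
      then show ?thesis using inner[OF g p[OF g] x] conn_trans by blast
    qed
    then show "\<forall>x\<in>core n (Suc k) z \<omega>. \<forall>y\<in>core n (Suc k) z \<omega>. (x, y) \<in> conn UNIV \<omega>"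
      using conn_sym conn_trans by blast
    fix z' assume z': "good n (Suc k) z' \<omega>" and "adjacent z z'"
    then consider "z' = (fst z + 1, snd z)" | "z' = (fst z, snd z + 1)" by (auto simp: adjacent_def)
    then show "\<exists>x\<in>core n (Suc k) z \<omega>. \<exists>y\<in>core n (Suc k) z' \<omega>. (x, y) \<in> conn UNIV \<omega>"
    proof cases
      case 1
      then obtain j where j: "j \<in> {16 * snd z..16 * snd z + 15}" "good_row n k z \<omega> j" "good_row n k z' \<omega> j"
        using common_good_row[OF z z'] by auto
      \<comment> \<open>In the common good row, the last child of \<open>z\<close> and the first
        child of \<open>z'\<close> are adjacent.\<close>
      have "good n k (16 * fst z + 15, j) \<omega> \<and> core n k (16 * fst z + 15, j) \<omega> \<subseteq> core n (Suc k) z \<omega>"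
        using j by (intro good_row_child) auto
      moreover have "good n k (16 * fst z + 16, j) \<omega> \<and> core n k (16 * fst z + 16, j) \<omega> \<subseteq> core n (Suc k) z' \<omega>"
        using j 1 by (intro good_row_child) auto
      moreover have "adjacent (16 * fst z + 15, j) (16 * fst z + 16, j)" by (simp add: adjacent_def)
      ultimately show ?thesis using adj by (meson subsetD)
    next
      case 2
      then obtain i where i: "i \<in> {16 * fst z..16 * fst z + 15}" "good_column n k z \<omega> i" "good_column n k z' \<omega> i"
        using common_good_column[OF z z'] by auto
      have "good n k (i, 16 * snd z + 15) \<omega> \<and> core n k (i, 16 * snd z + 15) \<omega> \<subseteq> core n (Suc k) z \<omega>"
        using i by (intro good_column_child) auto
      moreover have "good n k (i, 16 * snd z + 16) \<omega> \<and> core n k (i, 16 * snd z + 16) \<omega> \<subseteq> core n (Suc k) z' \<omega>"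
        using i 2 by (intro good_column_child) auto
      moreover have "adjacent (i, 16 * snd z + 15) (i, 16 * snd z + 16)" by (simp add: adjacent_def)
      ultimately show ?thesis using adj by (meson subsetD)
    qed
  qed
qed

text \<open>The index \<open>(0, 0)\<close> is its own child, so the cores at the origin increase
  with the scale. They all contain the origin, are connected, and contain the core of the remote
  child \<open>(15, 15)\<close>.\<close>

lemma good_children_percolate:
  assumes n: "n \<ge> 1" and sp: "\<omega> \<in> space config_space"
    and good: "\<And>k s. s \<in> children (0, 0) \<Longrightarrow> good n k s \<omega>"
  shows "\<omega> \<in> origin_to_infinity"
proof -
  have child: "core n k s \<omega> \<subseteq> core n (Suc k) (0, 0) \<omega>" if "s \<in> children (0, 0)" for k s
  proof -
    have "good_row n k (0, 0) \<omega> (snd s)"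
      using good that unfolding good_row_def by (auto simp: children_def)
    then show ?thesis using that by auto
  qed
  have zero: "(0, 0) \<in> children (0, 0)" by (simp add: children_def)
  have origin: "(0, 0) \<in> core n k (0, 0) \<omega>" for k
  proof (induction k)
    case 0
    then show ?case by (simp add: region_def)
  next
    case (Suc k)
    then show ?case using child[OF zero, of k] by blast
  qed
  have "\<exists>y. y \<notin> square_box m \<and> y \<in> cluster \<omega> (0, 0)" for m
  proof -
    \<comment> \<open>The region of this child starts at 14 times the side, beyond any prescribed
      box once the scale is large.\<close>
    have last: "(15, 15) \<in> children (0, 0)" by (simp add: children_def)
    obtain y where y: "y \<in> core n m (15, 15) \<omega>"
      using core_good[of n m \<omega>] good[OF last, of m] by blast
    then have "14 * int (side n m) \<le> fst y"
      using core_subset_region[of n m "(15, 15)" \<omega>] by (auto simp: region_def)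
    moreover have "m < side n m"
    proof -
      have "m < 2 ^ m" by (rule less_exp)
      also have "(2::nat) ^ m \<le> 16 ^ m" by (intro power_mono) auto
      also have "\<dots> \<le> side n m" using n by (simp add: side_def)
      finally show ?thesis .
    qed
    ultimately have "int m < fst y" by linarith
    then have "y \<notin> square_box m" by (auto simp: square_box_def)
    moreover have "((0, 0), y) \<in> conn UNIV \<omega>"
      using core_good[of n "Suc m" \<omega>] good[OF zero, of "Suc m"] origin[of "Suc m"] child[OF last] y
      by blast
    ultimately show ?thesis unfolding cluster_conn by blast
  qed
  then have "infinite (cluster \<omega> (0, 0))" unfolding infinite_iff_leaves_boxes by blast
  then show ?thesis using sp by (simp add: origin_to_infinity_def)
qed

definition bad :: "nat \<Rightarrow> nat \<Rightarrow> vertex \<Rightarrow> config set" where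
  "bad n k z = {\<omega> \<in> space config_space. \<not> good n k z \<omega>}"

lemma sets_bad: "bad n k z \<in> sets config_space"
proof -
  have "Measurable.pred config_space (good n k z)"
  proof (induction k arbitrary: z)
    case 0
    have "{\<omega> \<in> space config_space. good n 0 z \<omega>} = all_open (region n 0 z)"
      by (simp add: all_open_def)
    then show ?case using sets_all_open[OF finite_region] unfolding pred_def by simp
  next
    case (Suc k)
    note [measurable] = Suc
    show ?case unfolding good.simps Ball_def by measurable
  qed
  then show ?thesis unfolding bad_def by measurable
qed

lemma supported_bad: "supported_in (region n k z) (bad n k z)"
proof -
  have "good n k z \<omega> \<longleftrightarrow> good n k z \<omega>'"
    if "\<And>e. e \<in> edges \<Longrightarrow> e \<subseteq> region n k z \<Longrightarrow> \<omega> e = \<omega>' e" for \<omega> \<omega>'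
    using that
  proof (induction k arbitrary: z)
    case 0
    then show ?case by auto
  next
    case (Suc k)
    have "good n k s \<omega> \<longleftrightarrow> good n k s \<omega>'" if "s \<in> children z" for s
    proof (rule Suc.IH)
      show "\<omega> e = \<omega>' e" if "e \<in> edges" "e \<subseteq> region n k s" for e
        using Suc.prems that region_child_subset[OF \<open>s \<in> children z\<close>] by blast
    qed
    then show ?case by simp
  qed
  then show ?thesis unfolding supported_in_def depends_only_on_def bad_def by blast
qed

lemma bad_cascade:
  assumes "\<omega> \<in> bad n (Suc k) z"
  shows "\<exists>s\<in>nearby z. \<exists>t\<in>nearby z. far s t \<and> \<omega> \<in> bad n k s \<and> \<omega> \<in> bad n k t"
  using assms children_subset_nearby unfolding bad_def good.simps by blast

text \<open>A union bound over the 256 children of \<open>(0, 0)\<close> and over all scales gives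
  at most \<open>256 / 2401^2 < 1\<close>, so with positive probability every child is good at every
  scale.\<close>

lemma (in decoupled_percolation) percolation:
  assumes n: "n \<ge> 1"
    and init: "prob (all_open (region n 0 (0, 0))) \<ge> 1 - 1 / (4 * 2401^2)"
    and small: "\<And>k. (\<Sum>i<k. r (side n i)) \<le> 1 / (4 * (2401^2)^2)"
  shows "prob origin_to_infinity > 0"
proof -
  have init': "prob (bad n 0 z) \<le> 1 / (4 * 2401^2)" for z
  proof -
    have "bad n 0 z = space M - all_open (region n 0 z)" by (auto simp: bad_def all_open_def)
    then have "prob (bad n 0 z) = 1 - prob (all_open (region n 0 z))"
      using prob_compl[of "all_open (region n 0 z)"] sets_all_open[OF finite_region] by simp
    also have "prob (all_open (region n 0 z)) = prob (all_open (region n 0 (0, 0)))"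
      by (subst region_shift) (rule prob_all_open_shift[OF finite_region])
    finally show ?thesis using init by linarith
  qed
  obtain u where u: "\<And>k z. prob (bad n k z) \<le> u k" "summable u" "suminf u \<le> 1 / 2401^2"
    using multiscale_bound[OF n sets_bad supported_bad bad_cascade init' small] by blast
  define B where "B k = (\<Union>s\<in>children (0, 0). bad n k s)" for k
  have fin: "finite (children (0, 0))" and card: "card (children (0, 0)) = 256"
    by (simp_all add: children_def card_cartesian_product)
  have B_sets: "B k \<in> sets M" for k unfolding B_def using fin sets_bad by auto
  have B_le: "prob (B k) \<le> 256 * u k" for k
  proof -
    have "prob (B k) \<le> (\<Sum>s\<in>children (0, 0). prob (bad n k s))"
      unfolding B_def using fin sets_bad by (intro finite_measure_subadditive_finite) auto
    also have "\<dots> \<le> real (card (children (0, 0))) * u k"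
      using u(1) by (intro sum_bounded_above)
    finally show ?thesis by (simp add: card)
  qed
  have sm: "summable (\<lambda>k. 256 * u k)" using u(2) by (rule summable_mult)
  have smB: "summable (\<lambda>k. prob (B k))"
    using B_le by (intro summable_comparison_test'[OF sm, of 0]) auto
  have "prob (\<Union>k. B k) \<le> (\<Sum>k. prob (B k))"
    using B_sets smB by (intro finite_measure_subadditive_countably) auto
  also have "\<dots> \<le> (\<Sum>k. 256 * u k)" using B_le smB sm by (intro suminf_le)
  also have "\<dots> = 256 * suminf u" using u(2) by (rule suminf_mult)
  also have "\<dots> \<le> 256 * (1 / 2401^2)" using u(3) by (intro mult_left_mono) auto
  also have "\<dots> < 1" by simp
  finally have "prob (\<Union>k. B k) < 1" .
  moreover have "prob (space M - (\<Union>k. B k)) = 1 - prob (\<Union>k. B k)"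
    using B_sets by (intro prob_compl) auto
  moreover have "prob (space M - (\<Union>k. B k)) \<le> prob origin_to_infinity"
  proof (rule finite_measure_mono)
    show "space M - (\<Union>k. B k) \<subseteq> origin_to_infinity"
      using good_children_percolate[OF n] unfolding B_def bad_def by auto
  qed (use sets_origin_to_infinity in simp)
  ultimately show ?thesis by linarith
qed

section \<open>Summability along the scales and the critical parameter\<close>

text \<open>Cauchy condensation for \<open>r n / n\<close> cancels the denominator and yields
  summability of \<open>r (2 ^ n)\<close>; powers of 16 pick out every fourth term.\<close>

lemma summable_condensed:
  fixes r :: "nat \<Rightarrow> real"
  assumes nonneg: "\<And>n. n \<ge> 1 \<Longrightarrow> r n \<ge> 0"
    and antimono: "\<And>m n. 1 \<le> m \<Longrightarrow> m \<le> n \<Longrightarrow> r n \<le> r m"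
    and summable: "summable (\<lambda>n. r (Suc n) / real (Suc n))"
  shows "summable (\<lambda>k. r (16 ^ k))"
proof -
  define f where "f n = r n / real n" for n
  have "f n \<ge> 0" for n using nonneg[of n] by (cases "n = 0") (auto simp: f_def)
  moreover have "f (Suc m) \<le> f m" if "m > 0" for m
    unfolding f_def using that nonneg[of m] antimono[of m "Suc m"] by (intro frac_le) auto
  moreover have "summable f" using summable summable_Suc_iff[of f] by (simp add: f_def)
  ultimately have "summable (\<lambda>n. 2 ^ n * f (2 ^ n))" using condensation_test[of f] by blast
  then have s: "summable (\<lambda>n. r (2 ^ n))" by (simp add: f_def)
  have "summable ((\<lambda>n. r (2 ^ n)) \<circ> (\<lambda>k. 4 * k))"
    using nonneg by (intro summable_reindex[OF s]) (auto simp: inj_def)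
  then show ?thesis by (simp add: o_def power_mult)
qed

lemma small_tail:
  fixes g :: "nat \<Rightarrow> real"
  assumes "summable g" "\<And>k. g k \<ge> 0" "e > 0"
  obtains K where "\<And>k. (\<Sum>i<k. g (K + i)) \<le> e"
proof -
  obtain K where "norm (\<Sum>i. g (i + K)) < e"
    using suminf_exist_split[OF assms(3,1)] by blast
  then have "(\<Sum>i. g (i + K)) < e" by (simp add: abs_less_iff)
  moreover have "(\<Sum>i<k. g (i + K)) \<le> (\<Sum>i. g (i + K))" for k
    using assms(1,2) by (intro sum_le_suminf) (auto simp: summable_iff_shift)
  ultimately have "(\<Sum>i<k. g (K + i)) \<le> e" for k
    unfolding add.commute[of K] by (meson less_imp_le order_trans)
  then show ?thesis by (rule that)
qed

theorem theorem1p2: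
  fixes P :: "real \<Rightarrow> config measure"
    and r :: "nat \<Rightarrow> real"
  assumes model: "\<And>l. l \<in> {0..1} \<Longrightarrow> bond_percolation (P l)"
    and monotonicity: "\<And>A. increasing_event A \<Longrightarrow> mono_on {0..1} (\<lambda>l. measure (P l) A)"
    and invariance: "\<And>l. l \<in> {0..1} \<Longrightarrow> symmetry_invariant (P l)"
    and ergodicity: "\<And>l. l \<in> {0..1} \<Longrightarrow> shift_ergodic (P l)"
    and FKG: "\<And>l. l \<in> {0..1} \<Longrightarrow> FKG_inequality (P l)"
    and r_nonneg: "\<And>n. n \<ge> 1 \<Longrightarrow> r n \<ge> 0"
    and r_antimono: "\<And>m n. 1 \<le> m \<Longrightarrow> m \<le> n \<Longrightarrow> r n \<le> r m"
    and r_summable: "summable (\<lambda>n. r (Suc n) / real (Suc n))"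
    and decoupling: "\<And>n l A B. n \<ge> 1 \<Longrightarrow> l \<in> {0..1} \<Longrightarrow>
          A \<in> sets config_space \<Longrightarrow> B \<in> sets config_space \<Longrightarrow>
          supported_in (square_box (3 * n)) A \<Longrightarrow> supported_in (- square_box (4 * n)) B \<Longrightarrow>
          covariance (P l) (indicator A) (indicator B) \<le> r n"
    and limits: "\<And>A. increasing_event A \<Longrightarrow> finitely_supported A \<Longrightarrow> nontrivial_event A \<Longrightarrow>
          ((\<lambda>l. measure (P l) A) \<longlongrightarrow> 0) (at 0 within {0..1}) \<and>
          ((\<lambda>l. measure (P l) A) \<longlongrightarrow> 1) (at 1 within {0..1})"
  shows "percolating_parameters P \<noteq> {} \<and> critical_parameter P \<in> {0<..<1}"
proof -
  have dec: "decoupled_percolation (P l) r" if "l \<in> {0..1}" for l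
    using model invariance r_nonneg decoupling that by unfold_locales auto
  have "summable (\<lambda>k. r (16 ^ k))"
    using r_nonneg r_antimono r_summable by (rule summable_condensed)
  then obtain K where K: "\<And>k. (\<Sum>i<k. r (16 ^ (K + i))) \<le> 1 / (4 * (2401^2)^2)"
    using small_tail[of "\<lambda>k. r (16 ^ k)" "1 / (4 * (2401^2)^2)"] r_nonneg by auto
  \<comment> \<open>Now \<open>side n i = 16 ^ (K + i)\<close>, so the sums over scales are tails of
    the condensed series. The choice precedes that of the parameter, so one \<open>n\<close> and one
    box \<open>S\<close> serve both phases.\<close>
  define n :: nat where "n = 16 ^ K"
  have n: "n \<ge> 1" by (simp add: n_def)
  have small: "(\<Sum>i<k. r (side n i)) \<le> 1 / (4 * (2401^2)^2)" for k
    using K[of k] by (simp add: side_def n_def power_add)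
  define S where "S = region n 0 (0, 0)"
  have S: "finite S" by (simp add: S_def finite_region)
  have "{(0, 0), (1, 0)} \<in> edges" "{(0, 0), (1, 0)} \<subseteq> S"
    using n by (auto simp: edge_iff S_def region_def side_def)
  note fin = open_events_finitary[OF S this]
  have "((\<lambda>l. measure (P l) (some_open S)) \<longlongrightarrow> 0) (at 0 within {0..1})"
    using limits fin by blast
  then have "\<forall>\<^sub>F l in at 0 within {0..1}. measure (P l) (some_open S) < 1 / (4 * 2401^2)"
    by (rule order_tendstoD) simp
  then obtain d where d: "d > 0"
    "\<And>l. l \<in> {0..1} \<Longrightarrow> l \<noteq> 0 \<Longrightarrow> dist l 0 < d \<Longrightarrow> measure (P l) (some_open S) < 1 / (4 * 2401^2)"
    unfolding eventually_at by blast
  define l0 where "l0 = min (d / 2) (1 / 2)"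
  have l0: "0 < l0" "l0 < 1" "dist l0 0 < d" using d(1) by (auto simp: l0_def)
  then have P_l0: "measure (P l0) (some_open S) < 1 / (4 * 2401^2)" by (intro d(2)) auto
  \<comment> \<open>Monotonicity carries the estimate at \<open>l0\<close> down to all smaller
    parameters, including 0, about which the punctured filter \<open>at 0\<close> says
    nothing.\<close>
  have zero: "theta P l = 0" if l: "0 \<le> l" "l \<le> l0" for l
  proof -
    interpret decoupled_percolation "P l" r using dec l l0 by simp
    have "measure (P l) (some_open S) \<le> measure (P l0) (some_open S)"
      using mono_onD[OF monotonicity[OF fin(1)]] l l0 by simp
    then have "measure (P l) (some_open S) \<le> 1 / (4 * 2401^2)"
      using P_l0 by linarith
    then show ?thesis
      unfolding theta_def S_def by (rule no_percolation[OF n _ small])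
  qed
  have lower: "l0 \<le> l" if "l \<in> percolating_parameters P" for l
    using that zero[of l] by (auto simp: percolating_parameters_def not_le intro!: leI)

  have "((\<lambda>l. measure (P l) (all_open S)) \<longlongrightarrow> 1) (at 1 within {0..1})"
    using limits fin by blast
  then have "\<forall>\<^sub>F l in at 1 within {0..1}. measure (P l) (all_open S) > 1 - 1 / (4 * 2401^2)"
    by (rule order_tendstoD) simp
  then obtain d' where d': "d' > 0"
    "\<And>l. l \<in> {0..1} \<Longrightarrow> l \<noteq> 1 \<Longrightarrow> dist l 1 < d' \<Longrightarrow> measure (P l) (all_open S) > 1 - 1 / (4 * 2401^2)"
    unfolding eventually_at by blast
  \<comment> \<open>Percolation at a parameter strictly below 1 bounds the infimum away from 1; the
    lower cap \<open>1 / 2\<close> keeps \<open>l1\<close> in the unit interval.\<close>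
  define l1 where "l1 = max (1 - d' / 2) (1 / 2)"
  have l1: "0 \<le> l1" "l1 < 1" "dist l1 1 < d'" using d'(1) by (auto simp: l1_def dist_real_def)
  then have P_l1: "measure (P l1) (all_open S) > 1 - 1 / (4 * 2401^2)" by (intro d'(2)) auto
  interpret decoupled_percolation "P l1" r using dec l1 by simp
  have "theta P l1 > 0"
    unfolding theta_def using P_l1 unfolding S_def
    by (intro percolation[OF n _ small]) simp
  then have mem: "l1 \<in> percolating_parameters P" using l1 by (simp add: percolating_parameters_def)
  have "critical_parameter P \<le> l1"
    unfolding critical_parameter_def using mem lower by (intro cInf_lower bdd_belowI)
  moreover have "l0 \<le> critical_parameter P"
    unfolding critical_parameter_def using mem lower by (intro cInf_greatest) auto
  ultimately show ?thesis using mem l0 l1 by auto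
qed

end
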